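(* Let $n\ge1$ and let $\mathcal{H}\subseteq\mathcal{H}^{BC_n}$ be a sub-arrangement. The following are equivalent: (a) $\mathcal{H}$ is crystallographic, i.e. $\mathcal{H}=\{\mathrm{Ker}(\alpha):\alpha\in\Phi\}$ for some root subsystem $\Phi\subseteq BC_n$; (b) the graph $\mathcal{G}^{\mathcal{H}}$ is a projective crystallograph; (c) the graph $\mathcal{G}^{\mathcal{H}}$ is the projectification of a crystallograph.
   Context: Let $V=\mathbb{C}^n$ with canonical basis $(e_i)$ and dual basis $\alpha_i=e_i^\vee$, with the scalar product on $V^\vee$ making $(\alpha_i)$ orthonormal. Here $BC_n=\{\pm\alpha_i\pm\alpha_j: i\ne j\}\cup\{\pm\alpha_i,\pm2\alpha_i\}\subseteq V^\vee$; a root subsystem is a subset $\Phi\subseteq BC_n$ stable under the orthogonal reflections $\sigma_\alpha$ defined by its elements $\alpha\in\Phi$. Put $H^\pm_{ij}=\mathrm{Ker}(\alpha_i\pm\alpha_j)$ ($i\ne j$), $H_i=\mathrm{Ker}(\alpha_i)$; then $\mathcal{H}^{BC_n}=\{H^-_{ij},H^+_{ij}: i\neq j\}\cup\{H_i : 1\leq i\leq n\}$. A sub-arrangement is a subset. To $\mathcal{H}\subseteq\mathcal{H}^{BC_n}$ associate the edge-coloured graph $\mathcal{G}^{\mathcal{H}}$ on nodes $\{1,\dots,n\}$ with exactly: a red straight edge $\{i,j\}$ for each $H^-_{ij}\in\mathcal{H}$; a green straight edge $\{i,j\}$ for each $H^+_{ij}\in\mathcal{H}$; a blue loop edge at $k$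 for each $H_k\in\mathcal{H}$. A bichromatic graph has straight edges $\{i,j\}$ ($i\ne j$) and loop edges $\{k\}$ coloured red or green, with at most one edge of each colour on any given set of endpoints. It is a crystallograph if: (1) for any three distinct nodes $i,j,k$, if there are straight edges $\{i,j\}$, $\{j,k\}$ then there is a straight edge $\{i,k\}$, red if the first two have the same colour and green otherwise; (2) if a node $i$ is incident to a loop edge and to a straight edge $\{i,j\}$, then both the red and the green straight edge $\{i,j\}$ are present, as well as a loop edge at $j$ of the same colour as the one at $i$. A projective crystallograph is a graph whose straight edges are red or green, whose loop edges are all blue, with at most one edge of each colour on any given set of endpoints, satisfying the same conditions (1) and (2) (with blue loops in (2)). The projectification $\mathbb{P}(\mathcal{G})$ of a bichromatic graph $\mathcal{G}$ has the same nodes and straight edges, and a single blue loop at each node of $\mathcal{G}$ carrying at least one (red or green) loop. *)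

theory Defs
  imports "HOL-Analysis.Analysis"
begin

text \<open>
  The space V is \<open>complex ^ 'n\<close>, so n is \<open>CARD('n)\<close> and the indices \<open>1, ..., n\<close> are the elements
  of \<open>'n\<close>. Elements of the dual space are represented by the functions \<open>complex ^ 'n \<Rightarrow> complex\<close>
  that are complex-linear.
\<close>

definition dual_space :: "(complex ^ 'n \<Rightarrow> complex) set" where
  "dual_space = {f. Vector_Spaces.linear (*s) (*) f}"

definition \<alpha> :: "'n \<Rightarrow> complex ^ 'n \<Rightarrow> complex" where
  "\<alpha> i = (\<lambda>v. v $ i)"

text \<open>
  A functional \<open>f\<close> has coordinates \<open>f (axis i 1)\<close> with respect to the dual basis, so the following
  is the Hermitian scalar product for which the dual basis is orthonormal.
\<close>

definition dual_inner :: "(complex ^ 'n \<Rightarrow> complex) \<Rightarrow> (complex ^ 'n \<Rightarrow> complex) \<Rightarrow> complex" where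
  "dual_inner f g = (\<Sum>i\<in>UNIV. f (axis i 1) * cnj (g (axis i 1)))"

lemma dual_inner_alpha: "dual_inner (\<alpha> i) (\<alpha> j) = (if i = j then 1 else 0)"
  by (simp add: dual_inner_def \<alpha>_def axis_def if_distrib [of cnj] if_distrib [of "\<lambda>x. _ * x"]
      cong: if_cong)

definition reflection ::
  "(complex ^ 'n \<Rightarrow> complex) \<Rightarrow> (complex ^ 'n \<Rightarrow> complex) \<Rightarrow> (complex ^ 'n \<Rightarrow> complex)" where
  "reflection a f = (\<lambda>v. f v - 2 * dual_inner f a / dual_inner a a * a v)"

definition BC :: "(complex ^ 'n \<Rightarrow> complex) set" where
  "BC =
     {(\<lambda>v. s * \<alpha> i v + t * \<alpha> j v) | s t i j. s \<in> {1, -1} \<and> t \<in> {1, -1} \<and> i \<noteq> j} \<union>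
     {(\<lambda>v. c * \<alpha> i v) | c i. c \<in> {1, -1, 2, -2}}"

lemma BC_subset_dual_space: "(BC :: (complex ^ 'n \<Rightarrow> complex) set) \<subseteq> dual_space"
proof -
  have "(\<lambda>v. s * \<alpha> i v + t * \<alpha> j v) \<in> dual_space" for s t :: complex and i j :: 'n
    unfolding dual_space_def \<alpha>_def
    by (simp add: Vector_Spaces.linear_iff vec.vector_space_axioms
        vector_space_over_itself.vector_space_axioms algebra_simps)
  moreover have "(\<lambda>v. c * \<alpha> i v) \<in> dual_space" for c :: complex and i :: 'n
    unfolding dual_space_def \<alpha>_def
    by (simp add: Vector_Spaces.linear_iff vec.vector_space_axioms
        vector_space_over_itself.vector_space_axioms algebra_simps)
  ultimately show ?thesis
    unfolding BC_def by blast
qed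

definition root_subsystem :: "(complex ^ 'n \<Rightarrow> complex) set \<Rightarrow> bool" where
  "root_subsystem \<Phi> \<longleftrightarrow> \<Phi> \<subseteq> BC \<and> (\<forall>a\<in>\<Phi>. reflection a ` \<Phi> \<subseteq> \<Phi>)"

definition Ker :: "(complex ^ 'n \<Rightarrow> complex) \<Rightarrow> (complex ^ 'n) set" where
  "Ker f = {v. f v = 0}"

definition H_minus :: "'n \<Rightarrow> 'n \<Rightarrow> (complex ^ 'n) set" where
  "H_minus i j = Ker (\<lambda>v. \<alpha> i v - \<alpha> j v)"

definition H_plus :: "'n \<Rightarrow> 'n \<Rightarrow> (complex ^ 'n) set" where
  "H_plus i j = Ker (\<lambda>v. \<alpha> i v + \<alpha> j v)"

definition H_coord :: "'n \<Rightarrow> (complex ^ 'n) set" where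
  "H_coord i = Ker (\<alpha> i)"

definition BC_arrangement :: "(complex ^ 'n) set set" where
  "BC_arrangement =
     {H_minus i j | i j. i \<noteq> j} \<union> {H_plus i j | i j. i \<noteq> j} \<union> {H_coord i | i. True}"

definition crystallographic :: "(complex ^ 'n) set set \<Rightarrow> bool" where
  "crystallographic \<H> \<longleftrightarrow> (\<exists>\<Phi>. root_subsystem \<Phi> \<and> \<H> = Ker ` \<Phi>)"

datatype colour = Red | Green | Blue

text \<open>
  An edge is a colour together with its set of endpoints: a two-element set for a straight edge, a
  singleton for a loop. As the edges form a set, there is automatically at most one edge of each
  colour on any given set of endpoints.
\<close>

record 'v coloured_graph =
  nodes :: "'v set"
  edges :: "(colour \<times> 'v set) set"

definition straight_edges :: "'v coloured_graph \<Rightarrow> (colour \<times> 'v set) set" where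
  "straight_edges G = {(c, e) \<in> edges G. card e = 2}"

definition loop_edges :: "'v coloured_graph \<Rightarrow> (colour \<times> 'v set) set" where
  "loop_edges G = {(c, e) \<in> edges G. card e = 1}"

definition wf_graph :: "'v coloured_graph \<Rightarrow> bool" where
  "wf_graph G \<longleftrightarrow> (\<forall>(c, e)\<in>edges G. e \<subseteq> nodes G \<and> (card e = 1 \<or> card e = 2))"

definition bichromatic_graph :: "'v coloured_graph \<Rightarrow> bool" where
  "bichromatic_graph G \<longleftrightarrow> wf_graph G \<and> (\<forall>(c, e)\<in>edges G. c \<in> {Red, Green})"

definition straight_condition :: "'v coloured_graph \<Rightarrow> bool" where
  "straight_condition G \<longleftrightarrow>
     (\<forall>i\<in>nodes G. \<forall>j\<in>nodes G. \<forall>k\<in>nodes G. \<forall>c d.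
        i \<noteq> j \<and> j \<noteq> k \<and> i \<noteq> k \<and>
        (c, {i, j}) \<in> straight_edges G \<and> (d, {j, k}) \<in> straight_edges G \<longrightarrow>
        (if c = d then Red else Green, {i, k}) \<in> straight_edges G)"

definition loop_condition :: "'v coloured_graph \<Rightarrow> bool" where
  "loop_condition G \<longleftrightarrow>
     (\<forall>i\<in>nodes G. \<forall>j\<in>nodes G. \<forall>c d.
        i \<noteq> j \<and> (c, {i}) \<in> loop_edges G \<and> (d, {i, j}) \<in> straight_edges G \<longrightarrow>
        (Red, {i, j}) \<in> straight_edges G \<and> (Green, {i, j}) \<in> straight_edges G \<and>
        (c, {j}) \<in> loop_edges G)"

definition crystallograph :: "'v coloured_graph \<Rightarrow> bool" where
  "crystallograph G \<longleftrightarrow> bichromatic_graph G \<and> straight_condition G \<and> loop_condition G"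

definition projective_crystallograph :: "'v coloured_graph \<Rightarrow> bool" where
  "projective_crystallograph G \<longleftrightarrow>
     wf_graph G \<and>
     (\<forall>(c, e)\<in>straight_edges G. c \<in> {Red, Green}) \<and>
     (\<forall>(c, e)\<in>loop_edges G. c = Blue) \<and>
     straight_condition G \<and> loop_condition G"

definition projectification :: "'v coloured_graph \<Rightarrow> 'v coloured_graph" where
  "projectification G =
     \<lparr>nodes = nodes G,
      edges = straight_edges G \<union>
        {(Blue, {k}) | k. k \<in> nodes G \<and> (\<exists>c\<in>{Red, Green}. (c, {k}) \<in> loop_edges G)}\<rparr>"

definition arrangement_graph :: "(complex ^ 'n) set set \<Rightarrow> 'n coloured_graph" where
  "arrangement_graph \<H> =
     \<lparr>nodes = UNIV,
      edges = {(Red, {i, j}) | i j. i \<noteq> j \<and> H_minus i j \<in> \<H>} \<union>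
              {(Green, {i, j}) | i j. i \<noteq> j \<and> H_plus i j \<in> \<H>} \<union>
              {(Blue, {k}) | k. H_coord k \<in> \<H>}\<rparr>"

end

theory Submission imports Defs begin

text \<open>
  The equivalence of (a) and (b) rests on two observations about linear forms. A hyperplane
  determines its form up to a nonzero factor, and the kernel of \<open>reflection f g\<close> does not change
  when \<open>f\<close> and \<open>g\<close> are multiplied by nonzero scalars; so if \<open>\<H>\<close> is crystallographic, then
  \<open>Ker (reflection f g) \<in> \<H>\<close> for \<^emph>\<open>all\<close> forms \<open>f\<close>, \<open>g\<close> whose kernels lie in \<open>\<H>\<close>
  (\<open>crystallographic_reflection_closed\<close>), whichever root subsystem realises \<open>\<H>\<close>. The roots of
  type BC are, up to a scalar, the coordinates \<open>\<alpha> i\<close> and the forms \<open>\<alpha> i + s * \<alpha> j\<close> with a sign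
  \<open>s\<close>, where \<open>s = -1\<close> is a red edge and \<open>s = 1\<close> a green one. Up to
  exchanging the two nodes of a form, the only reflections that give a new hyperplane are

    \<^item> of \<open>\<alpha> j + t * \<alpha> k\<close> in \<open>\<alpha> i + s * \<alpha> j\<close>, proportional to \<open>\<alpha> i - s * t * \<alpha> k\<close>;

    \<^item> of \<open>\<alpha> i + s * \<alpha> j\<close> in \<open>\<alpha> i\<close>, proportional to \<open>\<alpha> i - s * \<alpha> j\<close>;

    \<^item> of \<open>\<alpha> i\<close> in \<open>\<alpha> i + s * \<alpha> j\<close>, proportional to \<open>\<alpha> j\<close>.

  The first is the straight condition, because \<open>- s * t\<close> is \<open>-1\<close> exactly when \<open>s = t\<close>; the
  other two are the loop condition. Hence closure under reflections is the crystallograph condition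
  (\<open>projective_crystallograph_arrangement_graph_iff\<close>). Conversely, given this closure, the forms
  \<open>\<plusminus> \<alpha> i\<close> and \<open>\<plusminus> (\<alpha> i + s * \<alpha> j)\<close> with kernel in \<open>\<H>\<close> form a root subsystem, and their
  kernels are all of \<open>\<H>\<close> (\<open>closed_imp_crystallographic\<close>).

  The equivalence of (b) and (c) holds for every graph: the two conditions only see the colour of a
  loop through its being carried along straight edges, so recolouring blue loops as red turns a
  projective crystallograph into a crystallograph, and identifying the two loop colours goes back.
\<close>

section \<open>Kernels and reflections of linear forms\<close>

lemma Ker_scale: "c \<noteq> 0 \<Longrightarrow> Ker (\<lambda>v. c * f v) = Ker f"
  by (simp add: Ker_def)

text \<open>
  The quotient by a hyperplane is one-dimensional: if \<open>g w \<noteq> 0\<close>, then every \<open>v\<close> differs from a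
  multiple of \<open>w\<close> by an element of the common kernel, so \<open>f\<close> is determined by \<open>f w\<close>.
\<close>

lemma dual_space_eq_Ker_proportional:
  fixes f g :: "complex ^ 'n \<Rightarrow> complex"
  assumes f: "f \<in> dual_space" and g: "g \<in> dual_space" and eq: "Ker f = Ker g"
  obtains c where "c \<noteq> 0" "f = (\<lambda>v. c * g v)"
proof (cases "\<exists>w. g w \<noteq> 0")
  case False
  then have "f = (\<lambda>v. 1 * g v)"
    using eq by (auto simp: Ker_def fun_eq_iff)
  then show ?thesis by (intro that[of 1]) auto
next
  case True
  then obtain w where w: "g w \<noteq> 0" by blast
  have lin: "h (x + y) = h x + h y" "h (r *s x) = r * h x"
    if "h \<in> dual_space" for h :: "complex ^ 'n \<Rightarrow> complex" and x y r
    using that unfolding dual_space_def by (auto simp: Vector_Spaces.linear_iff)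
  have iff: "f v = 0 \<longleftrightarrow> g v = 0" for v
    using eq by (auto simp: Ker_def set_eq_iff)
  show ?thesis
  proof (rule that)
    show "f w / g w \<noteq> 0" using w iff by simp
    show "f = (\<lambda>v. f w / g w * g v)"
    proof
      fix v
      have "g (v + (- (g v / g w)) *s w) = 0"
        using w by (simp only: lin[OF g]) simp
      then have "f (v + (- (g v / g w)) *s w) = 0"
        using iff by blast
      then have "f v = g v / g w * f w"
        by (simp only: lin[OF f]) (simp add: add_eq_0_iff)
      then show "f v = f w / g w * g v" by simp
    qed
  qed
qed

lemma dual_inner_scale_left: "dual_inner (\<lambda>v. c * f v) g = c * dual_inner f g"
  by (simp add: dual_inner_def sum_distrib_left mult.assoc)

lemma dual_inner_scale_right: "dual_inner f (\<lambda>v. c * g v) = cnj c * dual_inner f g"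
  by (simp add: dual_inner_def sum_distrib_left mult_ac)

lemma dual_inner_add_left: "dual_inner (\<lambda>v. f v + g v) h = dual_inner f h + dual_inner g h"
  by (simp add: dual_inner_def sum.distrib algebra_simps)

lemma dual_inner_add_right: "dual_inner f (\<lambda>v. g v + h v) = dual_inner f g + dual_inner f h"
  by (simp add: dual_inner_def sum.distrib algebra_simps)

lemma reflection_scale_root: "c \<noteq> 0 \<Longrightarrow> reflection (\<lambda>v. c * a v) f = reflection a f"
  by (simp add: reflection_def dual_inner_scale_left dual_inner_scale_right mult_ac)

lemma reflection_scale: "reflection a (\<lambda>v. c * f v) = (\<lambda>v. c * reflection a f v)"
  by (simp add: reflection_def dual_inner_scale_left right_diff_distrib mult_ac)

lemma reflection_orthogonal: "dual_inner f a = 0 \<Longrightarrow> reflection a f = f"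
  by (simp add: reflection_def)

lemma reflection_self: "dual_inner a a \<noteq> 0 \<Longrightarrow> reflection a a = (\<lambda>v. -1 * a v)"
  by (simp add: reflection_def)

text \<open>
  The root subsystem in the definition of crystallographic is only one of several with the same
  kernels, but the choice of roots on the two hyperplanes does not affect the kernel of the
  reflected form.
\<close>

lemma crystallographic_reflection_closed:
  assumes "crystallographic \<H>" and f: "f \<in> dual_space" "Ker f \<in> \<H>"
    and g: "g \<in> dual_space" "Ker g \<in> \<H>"
  shows "Ker (reflection f g) \<in> \<H>"
proof -
  obtain \<Phi> where \<Phi>: "root_subsystem \<Phi>" and \<H>: "\<H> = Ker ` \<Phi>"
    using assms(1) unfolding crystallographic_def by blast
  obtain a b where a: "a \<in> \<Phi>" "Ker f = Ker a" and b: "b \<in> \<Phi>" "Ker g = Ker b"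
    using f g \<H> by auto
  have "a \<in> dual_space" "b \<in> dual_space"
    using a b \<Phi> BC_subset_dual_space unfolding root_subsystem_def by blast+
  then obtain c d where c: "c \<noteq> 0" "f = (\<lambda>v. c * a v)" and d: "d \<noteq> 0" "g = (\<lambda>v. d * b v)"
    using dual_space_eq_Ker_proportional f g a b by metis
  have "Ker (reflection f g) = Ker (reflection a b)"
    by (simp add: c d reflection_scale_root reflection_scale Ker_scale)
  moreover have "reflection a b \<in> \<Phi>"
    using \<Phi> a b unfolding root_subsystem_def by blast
  ultimately show ?thesis using \<H> by simp
qed

section \<open>Straight forms\<close>

definition straight_form :: "'n \<Rightarrow> complex \<Rightarrow> 'n \<Rightarrow> complex ^ 'n \<Rightarrow> complex" where
  "straight_form i s j = (\<lambda>v. \<alpha> i v + s * \<alpha> j v)"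

lemma straight_form_in_BC: "i \<noteq> j \<Longrightarrow> s \<in> {1, -1} \<Longrightarrow> straight_form i s j \<in> BC"
  unfolding BC_def straight_form_def by (rule UnI1) force

lemma alpha_in_BC: "\<alpha> i \<in> BC"
  unfolding BC_def by (rule UnI2) force

lemma straight_form_swap:
  "s \<in> {1, -1} \<Longrightarrow> straight_form i s j = (\<lambda>v. s * straight_form j s i v)"
  by (auto simp: straight_form_def algebra_simps)

lemma Ker_straight_form_swap:
  "s \<in> {1, -1} \<Longrightarrow> Ker (straight_form j s i) = Ker (straight_form i s j)"
  by (subst straight_form_swap) (auto simp: Ker_def)

lemma Ker_straight_form: "Ker (straight_form i (-1) j) = H_minus i j"
  "Ker (straight_form i 1 j) = H_plus i j"
  by (simp_all add: straight_form_def H_minus_def H_plus_def)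

lemma dual_inner_alpha_straight_form:
  "dual_inner (\<alpha> k) (straight_form i s j) = (if k = i then 1 else 0) + (if k = j then cnj s else 0)"
  unfolding straight_form_def
  by (simp add: dual_inner_add_right dual_inner_scale_right dual_inner_alpha)

lemma dual_inner_straight_form:
  "dual_inner (straight_form i s j) f = dual_inner (\<alpha> i) f + s * dual_inner (\<alpha> j) f"
  unfolding straight_form_def by (simp add: dual_inner_add_left dual_inner_scale_left)

lemmas dual_inner_forms = dual_inner_alpha dual_inner_alpha_straight_form dual_inner_straight_form

lemma reflection_straight_form_swap:
  assumes "s \<in> {1, -1}"
  shows "reflection (straight_form i s j) f = reflection (straight_form j s i) f"
proof -
  have "s \<noteq> 0" using assms by auto
  then show ?thesis
    by (simp only: straight_form_swap[OF assms, of i j] reflection_scale_root not_False_eq_True)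
qed

lemma dual_inner_straight_form_self:
  assumes "i \<noteq> j" "s \<in> {1, -1}"
  shows "dual_inner (straight_form i s j) (straight_form i s j) = 2"
  using assms by (auto simp: dual_inner_forms)

lemma reflection_straight_adjacent:
  assumes d: "i \<noteq> j" "j \<noteq> k" "i \<noteq> k" and s: "s \<in> {1, -1}"
  shows "reflection (straight_form i s j) (straight_form j t k) =
    (\<lambda>v. - s * straight_form i (- s * t) k v)"
proof -
  have "dual_inner (straight_form j t k) (straight_form i s j) = s"
    using d s by (auto simp: dual_inner_forms)
  then show ?thesis
    unfolding reflection_def dual_inner_straight_form_self[OF d(1) s]
    using s by (auto simp: straight_form_def algebra_simps)
qed

lemma reflection_alpha_straight:
  assumes "i \<noteq> j"
  shows "reflection (\<alpha> i) (straight_form i s j) = (\<lambda>v. -1 * straight_form i (- s) j v)"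
proof -
  have "dual_inner (straight_form i s j) (\<alpha> i) = 1"
    using assms by (simp add: dual_inner_forms)
  then show ?thesis
    by (simp add: reflection_def dual_inner_alpha straight_form_def algebra_simps)
qed

lemma reflection_straight_alpha:
  assumes d: "i \<noteq> j" and s: "s \<in> {1, -1}"
  shows "reflection (straight_form i s j) (\<alpha> i) = (\<lambda>v. - s * \<alpha> j v)"
proof -
  have "dual_inner (\<alpha> i) (straight_form i s j) = 1"
    using d by (simp add: dual_inner_forms)
  then show ?thesis
    unfolding reflection_def dual_inner_straight_form_self[OF d s]
    by (simp add: straight_form_def algebra_simps)
qed

section \<open>The crystallograph conditions in terms of hyperplanes\<close>

definition straight_closed :: "(complex ^ 'n) set set \<Rightarrow> bool" where
  "straight_closed \<H> \<longleftrightarrow>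
     (\<forall>i j k. \<forall>s\<in>{1, -1}. \<forall>t\<in>{1, -1}. i \<noteq> j \<and> j \<noteq> k \<and> i \<noteq> k \<and>
        Ker (straight_form i s j) \<in> \<H> \<and> Ker (straight_form j t k) \<in> \<H> \<longrightarrow>
        Ker (straight_form i (- s * t) k) \<in> \<H>)"

definition loop_closed :: "(complex ^ 'n) set set \<Rightarrow> bool" where
  "loop_closed \<H> \<longleftrightarrow>
     (\<forall>i j. \<forall>s\<in>{1, -1}. i \<noteq> j \<and> Ker (\<alpha> i) \<in> \<H> \<and> Ker (straight_form i s j) \<in> \<H> \<longrightarrow>
        Ker (straight_form i (- s) j) \<in> \<H> \<and> Ker (\<alpha> j) \<in> \<H>)"

text \<open>
  A red or green straight edge \<open>{i, j}\<close> of colour \<open>c\<close> stands for the kernel of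
  \<open>\<alpha> i + colour_sign c * \<alpha> j\<close>.
\<close>

definition colour_sign :: "colour \<Rightarrow> complex" where
  "colour_sign c = (if c = Red then -1 else 1)"

lemma straight_edges_arrangement_graph:
  "(c, {i, j}) \<in> straight_edges (arrangement_graph \<H>) \<longleftrightarrow>
     i \<noteq> j \<and> c \<in> {Red, Green} \<and> Ker (straight_form i (colour_sign c) j) \<in> \<H>"
  using Ker_straight_form_swap[of 1 i j] Ker_straight_form_swap[of "-1" i j]
  by (cases c) (auto simp: straight_edges_def arrangement_graph_def colour_sign_def
      Ker_straight_form doubleton_eq_iff card_insert_if)

lemma loop_edges_arrangement_graph:
  "(c, {i}) \<in> loop_edges (arrangement_graph \<H>) \<longleftrightarrow> c = Blue \<and> Ker (\<alpha> i) \<in> \<H>"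
  by (auto simp: loop_edges_def arrangement_graph_def H_coord_def doubleton_eq_iff)

text \<open>
  In terms of signs, the rule "red if the colours agree, green otherwise" is the product \<open>- s * t\<close>.
  In the loop condition one of the two required straight edges is the given one, so it suffices to
  ask for the edge of opposite sign.
\<close>

lemma projective_crystallograph_arrangement_graph_iff:
  "projective_crystallograph (arrangement_graph \<H>) \<longleftrightarrow> straight_closed \<H> \<and> loop_closed \<H>"
proof -
  have "wf_graph (arrangement_graph \<H>)"
    "\<forall>(c, e)\<in>straight_edges (arrangement_graph \<H>). c \<in> {Red, Green}"
    "\<forall>(c, e)\<in>loop_edges (arrangement_graph \<H>). c = Blue"
    by (auto simp: wf_graph_def straight_edges_def loop_edges_def arrangement_graph_def)
  moreover have nodes: "nodes (arrangement_graph \<H>) = UNIV"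
    by (simp add: arrangement_graph_def)
  have all_colours: "(\<forall>c. Q c) \<longleftrightarrow> Q Red \<and> Q Green \<and> Q Blue" for Q
    by (metis colour.exhaust)
  have "straight_condition (arrangement_graph \<H>) \<longleftrightarrow> straight_closed \<H>"
    unfolding straight_condition_def straight_closed_def straight_edges_arrangement_graph nodes
      ball_UNIV
    by (intro iff_allI) (auto simp: all_colours colour_sign_def)
  moreover have "loop_condition (arrangement_graph \<H>) \<longleftrightarrow> loop_closed \<H>"
    unfolding loop_condition_def loop_closed_def straight_edges_arrangement_graph
      loop_edges_arrangement_graph nodes ball_UNIV
    by (intro iff_allI) (auto simp: all_colours colour_sign_def)
  ultimately show ?thesis
    unfolding projective_crystallograph_def by blast
qed

section \<open>Crystallographic arrangements\<close>

lemma crystallographic_imp_closed: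
  assumes "crystallographic \<H>"
  shows "straight_closed \<H>" "loop_closed \<H>"
proof -
  note closed = crystallographic_reflection_closed[OF assms]
  have dual: "\<alpha> i \<in> dual_space" "i \<noteq> j \<Longrightarrow> s \<in> {1, -1} \<Longrightarrow> straight_form i s j \<in> dual_space"
    for i j s
    using alpha_in_BC straight_form_in_BC BC_subset_dual_space by blast+
  show "straight_closed \<H>"
    unfolding straight_closed_def
  proof (intro allI ballI impI, elim conjE)
    fix i j k and s t :: complex
    assume st: "s \<in> {1, -1}" "t \<in> {1, -1}" and d: "i \<noteq> j" "j \<noteq> k" "i \<noteq> k"
      and H: "Ker (straight_form i s j) \<in> \<H>" "Ker (straight_form j t k) \<in> \<H>"
    have "Ker (\<lambda>v. - s * straight_form i (- s * t) k v) \<in> \<H>"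
      using closed[OF dual(2) H(1) dual(2) H(2)] st d
      by (simp only: reflection_straight_adjacent not_False_eq_True)
    then show "Ker (straight_form i (- s * t) k) \<in> \<H>"
      using st by (subst (asm) Ker_scale) auto
  qed
  show "loop_closed \<H>"
    unfolding loop_closed_def
  proof (intro allI ballI impI, elim conjE)
    fix i j and s :: complex
    assume s: "s \<in> {1, -1}" and d: "i \<noteq> j"
      and H: "Ker (\<alpha> i) \<in> \<H>" "Ker (straight_form i s j) \<in> \<H>"
    have "Ker (\<lambda>v. -1 * straight_form i (- s) j v) \<in> \<H>"
      using closed[OF dual(1) H(1) dual(2)[OF d s] H(2)]
      by (simp only: reflection_alpha_straight[OF d])
    moreover have "Ker (\<lambda>v. - s * \<alpha> j v) \<in> \<H>"
      using closed[OF dual(2)[OF d s] H(2) dual(1) H(1)]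
      by (simp only: reflection_straight_alpha[OF d s])
    ultimately show "Ker (straight_form i (- s) j) \<in> \<H> \<and> Ker (\<alpha> j) \<in> \<H>"
      using s Ker_scale[of "-1" "straight_form i (- s) j"] Ker_scale[of "- s" "\<alpha> j"] by auto
  qed
qed

text \<open>
  Among the four roots \<open>\<plusminus> \<alpha> i\<close>, \<open>\<plusminus> 2 * \<alpha> i\<close> on a coordinate hyperplane the short ones are
  chosen. Both signs of every form are present because the reflection in a form negates it.
\<close>

inductive_set reduced_roots :: "(complex ^ 'n) set set \<Rightarrow> (complex ^ 'n \<Rightarrow> complex) set"
  for \<H> where
  coord: "u \<in> {1, -1} \<Longrightarrow> Ker (\<alpha> i) \<in> \<H> \<Longrightarrow> (\<lambda>v. u * \<alpha> i v) \<in> reduced_roots \<H>"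
| straight: "u \<in> {1, -1} \<Longrightarrow> i \<noteq> j \<Longrightarrow> s \<in> {1, -1} \<Longrightarrow> Ker (straight_form i s j) \<in> \<H> \<Longrightarrow>
    (\<lambda>v. u * straight_form i s j v) \<in> reduced_roots \<H>"

lemma reduced_roots_sign:
  assumes "f \<in> reduced_roots \<H>" "w \<in> {1, -1}"
  shows "(\<lambda>v. w * f v) \<in> reduced_roots \<H>"
  using assms(1)
proof cases
  case (coord u i)
  then show ?thesis
    using reduced_roots.coord[of "w * u" i \<H>] assms(2) by (auto simp: mult.assoc)
next
  case (straight u i j s)
  then show ?thesis
    using reduced_roots.straight[of "w * u" i j s \<H>] assms(2) by (auto simp: mult.assoc)
qed

lemma reduced_roots_subset_BC: "reduced_roots \<H> \<subseteq> BC"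
proof
  fix f assume "f \<in> reduced_roots \<H>"
  then show "f \<in> BC"
  proof cases
    case (coord u i)
    then show ?thesis unfolding BC_def by (intro UnI2) blast
  next
    case (straight u i j s)
    have "f = (\<lambda>v. u * \<alpha> i v + u * s * \<alpha> j v)"
      using straight by (simp add: straight_form_def algebra_simps)
    moreover have "u * s \<in> {1, -1}" using straight by auto
    ultimately show ?thesis using straight unfolding BC_def by (intro UnI1) blast
  qed
qed

lemma Ker_image_reduced_roots:
  assumes "\<H> \<subseteq> BC_arrangement"
  shows "Ker ` reduced_roots \<H> = \<H>"
proof
  show "Ker ` reduced_roots \<H> \<subseteq> \<H>"
  proof (rule image_subsetI)
    fix f assume "f \<in> reduced_roots \<H>"
    then show "Ker f \<in> \<H>"
    proof cases
      case (coord u i)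
      then have "u \<noteq> 0" by auto
      with coord show ?thesis by (simp add: Ker_scale)
    next
      case (straight u i j s)
      then have "u \<noteq> 0" by auto
      with straight show ?thesis by (simp add: Ker_scale)
    qed
  qed
  show "\<H> \<subseteq> Ker ` reduced_roots \<H>"
  proof
    fix X assume X: "X \<in> \<H>"
    have unsigned: "Ker f \<in> Ker ` reduced_roots \<H>" if "(\<lambda>v. 1 * f v) \<in> reduced_roots \<H>" for f
      using imageI[OF that, of Ker] by simp
    have "X \<in> BC_arrangement" using X assms by (rule rev_subsetD)
    then consider i j where "i \<noteq> j" "X = Ker (straight_form i (-1) j)"
      | i j where "i \<noteq> j" "X = Ker (straight_form i 1 j)" | i where "X = Ker (\<alpha> i)"
      unfolding BC_arrangement_def Ker_straight_form H_coord_def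
      by (elim UnE CollectE exE conjE) simp_all
    then show "X \<in> Ker ` reduced_roots \<H>"
    proof cases
      case 1
      then show ?thesis using X unsigned[OF reduced_roots.straight[of 1 i j "-1"]] by simp
    next
      case 2
      then show ?thesis using X unsigned[OF reduced_roots.straight[of 1 i j 1]] by simp
    next
      case 3
      then show ?thesis using X unsigned[OF reduced_roots.coord[of 1 i]] by simp
    qed
  qed
qed

text \<open>
  The four lemmas below check stability of \<open>reduced_roots \<H>\<close> for the unsigned forms. This is
  enough, since signs can be pulled out of both arguments of a reflection.
\<close>

lemma reflection_straight_straight_mem:
  assumes closed: "straight_closed \<H>"
    and s: "s \<in> {1, -1}" and t: "t \<in> {1, -1}" and d: "i \<noteq> j" "k \<noteq> l"
    and H: "Ker (straight_form i s j) \<in> \<H>" "Ker (straight_form k t l) \<in> \<H>"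
  shows "reflection (straight_form i s j) (straight_form k t l) \<in> reduced_roots \<H>"
proof -
  \<comment> \<open>If the pairs of nodes overlap, two configurations matter: the same pair of nodes in the same order, and a path with
    middle node \<open>j = k\<close>. Swapping endpoints multiplies a form by a sign and reduces the others
    to these.\<close>
  have in_roots: "straight_form k t l \<in> reduced_roots \<H>"
    using reduced_roots.straight[of 1 k l t \<H>] d t H by simp
  have path: "reflection (straight_form x a y) (straight_form y b z) \<in> reduced_roots \<H>"
    if "x \<noteq> y" "y \<noteq> z" "x \<noteq> z" "a \<in> {1, -1}" "b \<in> {1, -1}"
      "Ker (straight_form x a y) \<in> \<H>" "Ker (straight_form y b z) \<in> \<H>" for x y z a b
  proof -
    have K: "Ker (straight_form x (- a * b) z) \<in> \<H>"
      using closed that unfolding straight_closed_def by blast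
    have "- a \<in> {1, -1}" "- a * b \<in> {1, -1}" using that by auto
    then show ?thesis
      unfolding reflection_straight_adjacent[OF that(1-4)]
      using K that by (intro reduced_roots.straight)
  qed
  have same: "reflection (straight_form k s l) (straight_form k t l) \<in> reduced_roots \<H>"
  proof (cases "s = t")
    case True
    have "reflection (straight_form k t l) (straight_form k t l) = (\<lambda>v. -1 * straight_form k t l v)"
      using d t by (intro reflection_self) (simp add: dual_inner_straight_form_self)
    then show ?thesis using True reduced_roots_sign[OF in_roots, of "-1"] by simp
  next
    case False
    then have "reflection (straight_form k s l) (straight_form k t l) = straight_form k t l"
      using d s t by (intro reflection_orthogonal) (auto simp: dual_inner_forms)
    then show ?thesis using in_roots by simp
  qed
  note swap_root = reflection_straight_form_swap[OF s, of i j]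
  have swap_arg: "reflection a (straight_form k t l) \<in> reduced_roots \<H>"
    if "reflection a (straight_form l t k) \<in> reduced_roots \<H>" for a
    using reduced_roots_sign[OF that t] by (simp only: straight_form_swap[OF t, of k] reflection_scale)
  have K: "Ker (straight_form j s i) \<in> \<H>" "Ker (straight_form l t k) \<in> \<H>"
    using H Ker_straight_form_swap s t by metis+
  consider "i = k" "j = l" | "i = l" "j = k" | "i = k" "j \<noteq> l" | "i = l" "j \<noteq> k"
    | "j = k" "i \<noteq> l" | "j = l" "i \<noteq> k" | "{i, j} \<inter> {k, l} = {}"
    by auto
  then show ?thesis
  proof cases
    case 1
    then show ?thesis using same by simp
  next
    case 2
    then show ?thesis unfolding swap_root using same by simp
  next
    case 3
    then show ?thesis unfolding swap_root using path[of j i l s t] d s t H K by simp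
  next
    case 4
    then show ?thesis unfolding swap_root using path[of j i k s t] d s t K by (intro swap_arg) auto
  next
    case 5
    then show ?thesis using path[of i j l s t] d s t H by simp
  next
    case 6
    then show ?thesis using path[of i j k s t] d s t H K by (intro swap_arg) auto
  next
    case 7
    then have "reflection (straight_form i s j) (straight_form k t l) = straight_form k t l"
      by (intro reflection_orthogonal) (auto simp: dual_inner_forms)
    then show ?thesis using in_roots by simp
  qed
qed

lemma reflection_alpha_alpha_mem:
  assumes "Ker (\<alpha> k) \<in> \<H>"
  shows "reflection (\<alpha> i) (\<alpha> k) \<in> reduced_roots \<H>"
proof (cases "i = k")
  case True
  then have "reflection (\<alpha> i) (\<alpha> k) = (\<lambda>v. -1 * \<alpha> k v)"
    using reflection_self[of "\<alpha> k"] by (simp add: dual_inner_alpha)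
  then show ?thesis using reduced_roots.coord[of "-1" k \<H>] assms by simp
next
  case False
  then have "reflection (\<alpha> i) (\<alpha> k) = \<alpha> k"
    by (intro reflection_orthogonal) (simp add: dual_inner_alpha)
  then show ?thesis using reduced_roots.coord[of 1 k \<H>] assms by simp
qed

lemma reflection_alpha_straight_mem:
  assumes closed: "loop_closed \<H>" and t: "t \<in> {1, -1}" and d: "k \<noteq> l"
    and H: "Ker (\<alpha> i) \<in> \<H>" "Ker (straight_form k t l) \<in> \<H>"
  shows "reflection (\<alpha> i) (straight_form k t l) \<in> reduced_roots \<H>"
proof -
  have t': "- t \<in> {1, -1}" using t by auto
  have incident: "reflection (\<alpha> x) (straight_form x t y) \<in> reduced_roots \<H>"
    if "x \<noteq> y" "Ker (\<alpha> x) \<in> \<H>" "Ker (straight_form x t y) \<in> \<H>" for x y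
  proof -
    have "Ker (straight_form x (- t) y) \<in> \<H>"
      using closed that t unfolding loop_closed_def by blast
    then show ?thesis
      unfolding reflection_alpha_straight[OF that(1)]
      using t' that by (intro reduced_roots.straight) auto
  qed
  consider "i = k" | "i = l" | "i \<noteq> k" "i \<noteq> l" by blast
  then show ?thesis
  proof cases
    case 1
    then show ?thesis using incident d H by simp
  next
    case 2
    then have "reflection (\<alpha> i) (straight_form l t k) \<in> reduced_roots \<H>"
      using incident d H t by (simp add: Ker_straight_form_swap)
    then show ?thesis
      using reduced_roots_sign t by (simp only: straight_form_swap[OF t, of k] reflection_scale)
  next
    case 3
    then have "reflection (\<alpha> i) (straight_form k t l) = straight_form k t l"
      by (intro reflection_orthogonal) (simp add: dual_inner_forms)
    then show ?thesis using reduced_roots.straight[of 1 k l t \<H>] d t H by simp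
  qed
qed

lemma reflection_straight_alpha_mem:
  assumes closed: "loop_closed \<H>" and s: "s \<in> {1, -1}" and d: "i \<noteq> j"
    and H: "Ker (straight_form i s j) \<in> \<H>" "Ker (\<alpha> k) \<in> \<H>"
  shows "reflection (straight_form i s j) (\<alpha> k) \<in> reduced_roots \<H>"
proof -
  have s': "- s \<in> {1, -1}" using s by auto
  have incident: "reflection (straight_form x s y) (\<alpha> x) \<in> reduced_roots \<H>"
    if "x \<noteq> y" "Ker (straight_form x s y) \<in> \<H>" "Ker (\<alpha> x) \<in> \<H>" for x y
  proof -
    have "Ker (\<alpha> y) \<in> \<H>"
      using closed that s unfolding loop_closed_def by blast
    then show ?thesis
      unfolding reflection_straight_alpha[OF that(1) s]
      using s' by (intro reduced_roots.coord)
  qed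
  consider "k = i" | "k = j" | "k \<noteq> i" "k \<noteq> j" by blast
  then show ?thesis
  proof cases
    case 1
    then show ?thesis using incident d H by simp
  next
    case 2
    have "reflection (straight_form i s j) (\<alpha> k) = reflection (straight_form j s i) (\<alpha> k)"
      by (rule reflection_straight_form_swap[OF s])
    then show ?thesis
      using incident[of j i] 2 d H s by (simp add: Ker_straight_form_swap)
  next
    case 3
    then have "reflection (straight_form i s j) (\<alpha> k) = \<alpha> k"
      by (intro reflection_orthogonal) (simp add: dual_inner_forms)
    then show ?thesis using reduced_roots.coord[of 1 k \<H>] H by simp
  qed
qed

lemma closed_imp_crystallographic:
  assumes \<H>: "\<H> \<subseteq> BC_arrangement" and closed: "straight_closed \<H>" "loop_closed \<H>"
  shows "crystallographic \<H>"
proof -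
  have "reflection a f \<in> reduced_roots \<H>"
    if a: "a \<in> reduced_roots \<H>" and f: "f \<in> reduced_roots \<H>" for a f
  proof -
    \<comment> \<open>Removes the sign of the root \<open>a\<close>; the cases for \<open>f\<close> remove the sign of \<open>f\<close>.\<close>
    from a have root: "reflection a r \<in> reduced_roots \<H>"
      if "\<And>i. Ker (\<alpha> i) \<in> \<H> \<Longrightarrow> reflection (\<alpha> i) r \<in> reduced_roots \<H>"
        "\<And>i j s. i \<noteq> j \<Longrightarrow> s \<in> {1, -1} \<Longrightarrow> Ker (straight_form i s j) \<in> \<H> \<Longrightarrow>
          reflection (straight_form i s j) r \<in> reduced_roots \<H>" for r
      using that by cases (auto simp: reflection_scale_root[where c = "-1", simplified])
    from f show ?thesis
    proof cases
      case (coord u k)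
      have "reflection a (\<alpha> k) \<in> reduced_roots \<H>"
        using coord reflection_alpha_alpha_mem reflection_straight_alpha_mem[OF closed(2)]
        by (intro root) auto
      then show ?thesis
        using coord reduced_roots_sign by (simp only: reflection_scale)
    next
      case (straight u k l t)
      have "reflection a (straight_form k t l) \<in> reduced_roots \<H>"
        using straight
        by (intro root reflection_alpha_straight_mem[OF closed(2)]
            reflection_straight_straight_mem[OF closed(1)])
      then show ?thesis
        using straight reduced_roots_sign by (simp only: reflection_scale)
    qed
  qed
  then have "root_subsystem (reduced_roots \<H>)"
    unfolding root_subsystem_def using reduced_roots_subset_BC by auto
  then show ?thesis
    unfolding crystallographic_def using Ker_image_reduced_roots[OF \<H>] by metis
qed

section \<open>Projectification\<close>

lemma straight_edges_projectification: "straight_edges (projectification G) = straight_edges G"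
  by (auto simp: projectification_def straight_edges_def)

lemma loop_edges_projectification:
  "(c, {k}) \<in> loop_edges (projectification G) \<longleftrightarrow>
     c = Blue \<and> k \<in> nodes G \<and> (\<exists>d\<in>{Red, Green}. (d, {k}) \<in> loop_edges G)"
  by (auto simp: projectification_def loop_edges_def straight_edges_def)

lemma projective_crystallograph_projectification:
  assumes "crystallograph G"
  shows "projective_crystallograph (projectification G)"
proof -
  have wf: "wf_graph G" and col: "\<And>c e. (c, e) \<in> edges G \<Longrightarrow> c \<in> {Red, Green}"
    and s: "straight_condition G" and l: "loop_condition G"
    using assms unfolding crystallograph_def bichromatic_graph_def by auto
  have nodes: "nodes (projectification G) = nodes G"
    by (simp add: projectification_def)
  have "wf_graph (projectification G)"
    using wf by (auto simp: wf_graph_def projectification_def straight_edges_def)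
  moreover have "\<forall>(c, e)\<in>straight_edges (projectification G). c \<in> {Red, Green}"
    unfolding straight_edges_projectification using col by (auto simp: straight_edges_def)
  moreover have "\<forall>(c, e)\<in>loop_edges (projectification G). c = Blue"
    by (auto simp: projectification_def loop_edges_def straight_edges_def)
  moreover have "straight_condition (projectification G)"
    using s unfolding straight_condition_def straight_edges_projectification nodes .
  moreover have "loop_condition (projectification G)"
    using l unfolding loop_condition_def straight_edges_projectification
      loop_edges_projectification nodes by blast
  ultimately show ?thesis unfolding projective_crystallograph_def by blast
qed

text \<open>
  All loops of the lift get the same colour, since the loop condition carries the colour of a loop
  along a straight edge.
\<close>

definition red_lift :: "'v coloured_graph \<Rightarrow> 'v coloured_graph" where
  "red_lift P = \<lparr>nodes = nodes P,
     edges = straight_edges P \<union> {(Red, {k}) | k. (Blue, {k}) \<in> loop_edges P}\<rparr>"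

lemma straight_edges_red_lift: "straight_edges (red_lift P) = straight_edges P"
  by (auto simp: red_lift_def straight_edges_def)

lemma loop_edges_red_lift:
  "(c, {k}) \<in> loop_edges (red_lift P) \<longleftrightarrow> c = Red \<and> (Blue, {k}) \<in> loop_edges P"
  by (auto simp: red_lift_def loop_edges_def straight_edges_def)

lemma crystallograph_red_lift:
  assumes "projective_crystallograph P"
  shows "crystallograph (red_lift P)"
proof -
  have wf: "wf_graph P" and s: "straight_condition P" and l: "loop_condition P"
    and col: "\<And>c e. (c, e) \<in> straight_edges P \<Longrightarrow> c \<in> {Red, Green}"
    using assms unfolding projective_crystallograph_def by auto
  have nodes: "nodes (red_lift P) = nodes P"
    by (simp add: red_lift_def)
  have "bichromatic_graph (red_lift P)"
    using wf col by (fastforce simp: bichromatic_graph_def wf_graph_def red_lift_def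
        straight_edges_def loop_edges_def)
  moreover have "straight_condition (red_lift P)"
    using s unfolding straight_condition_def straight_edges_red_lift nodes .
  moreover have "loop_condition (red_lift P)"
    using l unfolding loop_condition_def straight_edges_red_lift loop_edges_red_lift nodes by blast
  ultimately show ?thesis unfolding crystallograph_def by blast
qed

lemma projectification_red_lift:
  fixes P :: "'v coloured_graph"
  assumes "projective_crystallograph P"
  shows "projectification (red_lift P) = P"
proof -
  have wf: "\<And>c e. (c, e) \<in> edges P \<Longrightarrow> e \<subseteq> nodes P \<and> (card e = 1 \<or> card e = 2)"
    and col: "\<And>c e. (c, e) \<in> loop_edges P \<Longrightarrow> c = Blue"
    using assms unfolding projective_crystallograph_def wf_graph_def by auto
  have loops: "(Blue, {k}) \<in> loop_edges P \<Longrightarrow> k \<in> nodes P" for k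
    using wf by (auto simp: loop_edges_def)
  have "edges P = straight_edges P \<union> loop_edges P"
    using wf by (auto simp: straight_edges_def loop_edges_def)
  also have "loop_edges P = {(Blue, {k}) | k. (Blue, {k}) \<in> loop_edges P}"
  proof -
    have "\<exists>k. c = Blue \<and> e = {k}" if "(c, e) \<in> loop_edges P" for c e
      using that col[OF that] by (auto simp: loop_edges_def card_1_singleton_iff)
    then show ?thesis by fastforce
  qed
  also have "\<dots> = {(Blue, {k}) | k. k \<in> nodes (red_lift P) \<and>
      (\<exists>c\<in>{Red, Green}. (c, {k}) \<in> loop_edges (red_lift P))}"
    unfolding loop_edges_red_lift using loops by (auto simp: red_lift_def)
  finally have "edges P = edges (projectification (red_lift P))"
    by (simp add: projectification_def straight_edges_red_lift)
  moreover have "nodes (projectification (red_lift P)) = nodes P"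
    by (simp add: projectification_def red_lift_def)
  ultimately show ?thesis by simp
qed

text \<open>
  The colour of the loops is forgotten by projectification, which makes \<open>red_lift\<close> a section of it
  over the projective crystallographs.
\<close>

lemma projective_crystallograph_iff_projectification:
  "projective_crystallograph P \<longleftrightarrow> (\<exists>G. crystallograph G \<and> P = projectification G)"
  using projective_crystallograph_projectification crystallograph_red_lift projectification_red_lift
  by metis

section \<open>The equivalence\<close>

theorem theorem7p3p2:
  fixes \<H> :: "(complex ^ 'n) set set"
  assumes "\<H> \<subseteq> BC_arrangement"
  shows "(crystallographic \<H> \<longleftrightarrow> projective_crystallograph (arrangement_graph \<H>)) \<and>
         (projective_crystallograph (arrangement_graph \<H>) \<longleftrightarrow>
            (\<exists>G. crystallograph G \<and> arrangement_graph \<H> = projectification G))"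
  using crystallographic_imp_closed closed_imp_crystallographic[OF assms]
    projective_crystallograph_arrangement_graph_iff projective_crystallograph_iff_projectification
  by blast

end
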